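(* Let $n\in\mathbb{N}$ and $\ell=(2n+1)/2$. Let $W$ be the $(2\ell+1)\times(2\ell+1)$ weight matrix on $[-1,1]$ defined in the context, and write it in $(n+1)\times(n+1)$ blocks as $$W(x)=\begin{pmatrix} A(x) & B(x) \\ {B(x)}^{dt} & {A(x)}^{dt} \end{pmatrix}.$$ Then $$YW(x)Y^t=\begin{pmatrix} W_1(x) & 0 \\ 0 & W_2(x) \end{pmatrix},\qquad W_1(x)=A(x)+B(x)J_{n+1},\quad W_2(x)=J_{n+1}F_{n+1}W_1(-x)F_{n+1}J_{n+1}.$$ Moreover, if $\{P_{d,1}\}_{d\ge0}$ is the sequence of monic orthogonal polynomials with respect to $W_1(x)$, then $$P_{d,2}(x)=(-1)^dJ_{n+1}F_{n+1}P_{d,1}(-x)F_{n+1}J_{n+1},\quad d\ge0,$$ is the sequence of monic orthogonal polynomials with respect to $W_2(x)$.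
   Context: Rows and columns of $W$ are indexed by $\{0,1,\dots,2\ell\}$. $(a)_k=a(a+1)\cdots(a+k-1)$, $(a)_0=1$; $U_k$ is the Chebyshev polynomial of the second kind of degree $k$. The weight matrix is, for $m\le k$, $$W(x)_{k,m}=(1-x^2)^{\frac12}\,\frac{2\ell+1}{k+1}\,\frac{(2\ell-m)!\,m!}{(2\ell)!}\sum_{t=0}^m(-1)^{m-t}\frac{(k-2\ell)_{m-t}}{(k+2)_{m-t}}\frac{(2\ell+2-t)_t}{t!}\,U_{k+m-2t}(x),$$ and $W(x)_{k,m}=W(x)_{m,k}$ if $k<m$. For an $N\times N$ matrix $X$, $X^{dt}=J_NXJ_N$, where $J_N=\sum_{i=0}^{N-1}E_{i,N-1-i}$; also $F_N=\sum_{i=0}^{N-1}(-1)^iE_{i,i}$ and $I_N$ is the identity. ($W$ does have the block form displayed in the claim because $J_{2\ell+1}WJ_{2\ell+1}=W$.) $$Y=\frac1{\sqrt2}\begin{pmatrix} I_{n+1} & J_{n+1} \\ -J_{n+1} & I_{n+1} \end{pmatrix}.$$ Monic orthogonal polynomials with respect to a weight $\mathcal W$ on $(-1,1)$: matrix polynomials $P_d$ of degree $d$ with leading coefficient $I$ and $\int_{-1}^1P_d\mathcal WP_{d'}^*\,dx=0$ for $d\ne d'$. *)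

theory Defs
  imports
    "HOL-Analysis.Analysis"
    "HOL-Computational_Algebra.Polynomial"
    "Jordan_Normal_Form.Schur_Decomposition"
begin

text \<open>All matrices are taken over the complex numbers, with rows and columns numbered from 0;
  weights and matrix polynomials are functions of a real variable.\<close>

fun cheb_U :: "nat \<Rightarrow> real \<Rightarrow> real" where
  "cheb_U 0 x = 1"
| "cheb_U (Suc 0) x = 2 * x"
| "cheb_U (Suc (Suc k)) x = 2 * x * cheb_U (Suc k) x - cheb_U k x"

text \<open>The parameter \<open>L\<close> stands for $2\ell$. The entries in and below the diagonal (\<open>m \<le> k\<close>) are given
  by \<open>weight_entry L k m x\<close>; none of the subtractions of natural numbers truncates there. The first
  argument of \<^const>\<open>pochhammer\<close> is a real number, negative or zero for $(k-2\ell)_{m-t}$.\<close>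

definition weight_entry :: "nat \<Rightarrow> nat \<Rightarrow> nat \<Rightarrow> real \<Rightarrow> real" where
  "weight_entry L k m x =
     sqrt (1 - x\<^sup>2) * ((real L + 1) / (real k + 1)) * (fact (L - m) * fact m / fact L) *
     (\<Sum>t = 0..m. (-1) ^ (m - t)
        * (pochhammer (real k - real L) (m - t) / pochhammer (real k + 2) (m - t))
        * (pochhammer (real L + 2 - real t) t / fact t)
        * cheb_U (k + m - 2 * t) x)"

definition weight_W :: "nat \<Rightarrow> real \<Rightarrow> complex mat" where
  "weight_W L x = mat (L + 1) (L + 1) (\<lambda>(k, m).
     complex_of_real (if m \<le> k then weight_entry L k m x else weight_entry L m k x))"

definition J_mat :: "nat \<Rightarrow> complex mat" where
  "J_mat N = mat N N (\<lambda>(i, j). if j = N - 1 - i then 1 else 0)"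

definition F_mat :: "nat \<Rightarrow> complex mat" where
  "F_mat N = mat N N (\<lambda>(i, j). if i = j then (-1) ^ i else 0)"

text \<open>$X^{dt}$, for square \<open>X\<close>.\<close>

definition dt_mat :: "complex mat \<Rightarrow> complex mat" where
  "dt_mat X = J_mat (dim_row X) * X * J_mat (dim_row X)"

definition Y_mat :: "nat \<Rightarrow> complex mat" where
  "Y_mat n = complex_of_real (1 / sqrt 2) \<cdot>\<^sub>m
     four_block_mat (1\<^sub>m (n + 1)) (J_mat (n + 1)) (- J_mat (n + 1)) (1\<^sub>m (n + 1))"

text \<open>The upper left and upper right blocks of the weight matrix with $2\ell = 2n + 1$.\<close>

definition block_A :: "nat \<Rightarrow> real \<Rightarrow> complex mat" where
  "block_A n x = mat (n + 1) (n + 1) (\<lambda>(i, j). weight_W (2 * n + 1) x $$ (i, j))"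

definition block_B :: "nat \<Rightarrow> real \<Rightarrow> complex mat" where
  "block_B n x = mat (n + 1) (n + 1) (\<lambda>(i, j). weight_W (2 * n + 1) x $$ (i, n + 1 + j))"

definition monic_matrix_poly :: "nat \<Rightarrow> nat \<Rightarrow> (real \<Rightarrow> complex mat) \<Rightarrow> bool" where
  "monic_matrix_poly N d P \<longleftrightarrow>
     (\<exists>Q :: complex poly mat. Q \<in> carrier_mat N N \<and>
        (\<forall>i < N. \<forall>j < N. degree (Q $$ (i, j)) \<le> d) \<and>
        map_mat (\<lambda>q. coeff q d) Q = 1\<^sub>m N \<and>
        (\<forall>x. P x = map_mat (\<lambda>q. poly q (complex_of_real x)) Q))"

text \<open>The matrix integral is taken entrywise. Integrability is required explicitly because the
  Lebesgue integral of a non-integrable function is 0 by convention.\<close>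

definition monic_orthogonal_polys ::
    "nat \<Rightarrow> (real \<Rightarrow> complex mat) \<Rightarrow> (nat \<Rightarrow> real \<Rightarrow> complex mat) \<Rightarrow> bool" where
  "monic_orthogonal_polys N V P \<longleftrightarrow>
     (\<forall>d. monic_matrix_poly N d (P d)) \<and>
     (\<forall>d d'. d \<noteq> d' \<longrightarrow> (\<forall>i < N. \<forall>j < N.
        set_integrable lborel {-1<..<1} (\<lambda>x. (P d x * V x * mat_adjoint (P d' x)) $$ (i, j)) \<and>
        (LINT x:{-1<..<1}|lborel. (P d x * V x * mat_adjoint (P d' x)) $$ (i, j)) = 0))"

end

theory Submission
  imports Defs
begin

text \<open>
  Two symmetries of the weight carry the whole argument. Write $L = 2\ell = 2n+1$.

  The first is invariance under a half turn, $W_{L-i,L-j} = W_{i,j}$. It is invisible in the defining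
  sum, but putting $t = m - s$ and writing the Pochhammer symbols as quotients of factorials turns the
  entry ($m \<le> k$) into a constant times $(1-x^2)^{1/2}$ times
  \[ (L-m)!\,m!\,k!\,(L-k)! \sum_{s=0}^{\min(m,L-k)}
     \frac{U_{k-m+2s}(x)}{(L-k-s)!\,(k+1+s)!\,(L+1-m+s)!\,(m-s)!} , \]
  which is unchanged when $(k,m)$ is replaced by $(L-m,L-k)$: the factorials only trade places
  (\<open>weight_entry_closed_form\<close>, \<open>weight_entry_flip\<close>). Hence the lower blocks of \<open>W\<close> are the flips
  of the upper ones, and \<open>Y\<close>, which passes to the symmetric and antisymmetric vectors of the half
  turn, splits \<open>W\<close> into $A + BJ$ and $JAJ - JB$; this is block algebra with $J^2 = I$
  (\<open>Y_block_diagonalization\<close>).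

  The second is parity, $W_{i,j}(-x) = (-1)^{i+j} W_{i,j}(x)$, inherited from $U_k(-x) = (-1)^k U_k(x)$.
  The column offset $n+1$ of \<open>B\<close> makes the signs of \<open>A\<close> and \<open>BJ\<close> differ by one factor of $-1$, so
  conjugating $W_1(-x)$ by $JF$ gives exactly $JAJ - JB$ (\<open>signed_flip_W1\<close>).

  The claim on orthogonal polynomials holds for every weight on the symmetric interval. Conjugation by
  the real orthogonal matrix $JF$ is multiplicative and commutes with adjoints, and so
  $P_{d,2} W_2 P_{d',2}^*$ at $x$ is, up to sign, the conjugate of $P_{d,1} W_1 P_{d',1}^*$ at $-x$. The
  substitution $x \mapsto -x$ preserves vanishing integrals, and the factor $(-1)^d$ restores the
  leading coefficient (\<open>monic_orthogonal_polys_signed_flip\<close>).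
\<close>

section \<open>Parity of the weight\<close>

lemma cheb_U_uminus: "cheb_U k (- x) = (-1) ^ k * cheb_U k x"
proof (induction k x rule: cheb_U.induct)
  case (3 k x)
  then show ?case unfolding cheb_U.simps by (simp add: right_diff_distrib)
qed simp_all

lemma minus_one_power_cong:
  assumes "even a \<longleftrightarrow> even b"
  shows "(-1 :: 'a :: ring_1) ^ a = (-1) ^ b"
  using assms by (simp only: minus_one_power_iff)

text \<open>All Chebyshev degrees $k+m-2t$ in an entry have the parity of $k+m$.\<close>

lemma weight_entry_uminus:
  assumes "m \<le> k"
  shows "weight_entry L k m (- x) = (-1) ^ (k + m) * weight_entry L k m x"
proof -
  have U: "cheb_U (k + m - 2 * t) (- x) = (-1) ^ (k + m) * cheb_U (k + m - 2 * t) x"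
    if "t \<in> {0..m}" for t
  proof -
    have "even (k + m - 2 * t) \<longleftrightarrow> even (k + m)" using that assms by auto
    then have "(-1::real) ^ (k + m - 2 * t) = (-1) ^ (k + m)" by (simp only: minus_one_power_iff)
    then show ?thesis by (simp only: cheb_U_uminus)
  qed
  have "(\<Sum>t = 0..m. c t * cheb_U (k + m - 2 * t) (- x))
      = (-1) ^ (k + m) * (\<Sum>t = 0..m. c t * cheb_U (k + m - 2 * t) x)" for c :: "nat \<Rightarrow> real"
    unfolding sum_distrib_left by (intro sum.cong refl) (simp only: U mult.left_commute)
  then show ?thesis unfolding weight_entry_def by (simp only: power2_minus mult.left_commute)
qed

section \<open>Invariance of the weight under the half turn\<close>

lemma pochhammer_of_nat_plus_1: "pochhammer (of_nat a + 1 :: real) s = fact (a + s) / fact a"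
proof (induction s)
  case (Suc s)
  have "pochhammer (of_nat a + 1 :: real) (Suc s) = fact (a + s) / fact a * (real a + 1 + real s)"
    by (simp add: pochhammer_Suc Suc.IH)
  also have "\<dots> = fact (a + Suc s) / fact a" by (simp add: mult.commute add_ac)
  finally show ?case .
qed simp

lemma pochhammer_minus_of_nat:
  assumes "s \<le> a"
  shows "(-1) ^ s * pochhammer (- real a) s = fact a / fact (a - s)"
proof -
  have *: "real a - real s + 1 = real (a - s) + 1" using assms by simp
  have "(-1) ^ s * pochhammer (- real a) s = pochhammer (real (a - s) + 1) s"
    unfolding pochhammer_minus * by (simp flip: mult.assoc power_mult_distrib)
  also have "\<dots> = fact a / fact (a - s)"
    unfolding pochhammer_of_nat_plus_1 using assms by simp
  finally show ?thesis .
qed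

text \<open>The point of this form is that the prefactor is symmetric in the pairs $\{m, L-k\}$ and
  $\{k, L-m\}$, and so is the summation range. The range stops at $L-k$ because
  $(k-L)_s$ contains the factor $0$ for larger $s$.\<close>

lemma weight_entry_closed_form:
  assumes "m \<le> k" "k \<le> L"
  shows "weight_entry L k m x =
    sqrt (1 - x\<^sup>2) * ((real L + 1) * fact (L + 1) / fact L) * (fact (L - m) * fact m * fact k * fact (L - k)) *
    (\<Sum>s\<le>min m (L - k). cheb_U (k - m + 2 * s) x /
       (fact (L - k - s) * fact (k + 1 + s) * fact (L + 1 - m + s) * fact (m - s)))"
proof -
  define g where "g t = (-1) ^ (m - t)
        * (pochhammer (real k - real L) (m - t) / pochhammer (real k + 2) (m - t))
        * (pochhammer (real L + 2 - real t) t / fact t)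
        * cheb_U (k + m - 2 * t) x" for t
  have vanish: "g (m - s) = 0" if "s \<in> {..m} - {..min m (L - k)}" for s
  proof -
    have "pochhammer (- real (L - k)) s = 0"
      using that by (intro pochhammer_of_nat_eq_0_lemma) auto
    then show ?thesis using that assms by (simp add: g_def of_nat_diff)
  qed
  have coeff: "g (m - s) = fact (L - k) * fact (k + 1) * fact (L + 1) *
      (cheb_U (k - m + 2 * s) x /
       (fact (L - k - s) * fact (k + 1 + s) * fact (L + 1 - m + s) * fact (m - s)))"
    if "s \<in> {..min m (L - k)}" for s
  proof -
    have s: "s \<le> m" "s \<le> L - k" using that by auto
    have 1: "(-1) ^ s * pochhammer (real k - real L) s = fact (L - k) / fact (L - k - s)"
      using pochhammer_minus_of_nat[OF s(2)] assms by (simp add: of_nat_diff)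
    have 2: "pochhammer (real k + 2) s = fact (k + 1 + s) / fact (k + 1)"
      using pochhammer_of_nat_plus_1[of "k + 1" s] by (simp add: add_ac)
    have "real L + 2 - real (m - s) = real (L + 1 - m + s) + 1"
      using s assms by (simp add: of_nat_diff)
    moreover have "L + 1 - m + s + (m - s) = L + 1" using s assms by simp
    ultimately have 3: "pochhammer (real L + 2 - real (m - s)) (m - s)
        = fact (L + 1) / fact (L + 1 - m + s)"
      by (simp only: pochhammer_of_nat_plus_1)
    have 4: "k + m - 2 * (m - s) = k - m + 2 * s" "m - (m - s) = s" using s assms by auto
    have "g (m - s) = ((-1) ^ s * pochhammer (real k - real L) s) / pochhammer (real k + 2) s
        * (pochhammer (real L + 2 - real (m - s)) (m - s) / fact (m - s)) * cheb_U (k - m + 2 * s) x"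
      unfolding g_def 4 by simp
    then show ?thesis unfolding 1 2 3 by (simp del: fact_Suc)
  qed
  have "(\<Sum>t = 0..m. g t) = (\<Sum>s\<le>m. g (m - s))"
    by (simp add: sum.atLeastAtMost_rev[of g 0 m] atMost_atLeast0)
  also have "\<dots> = (\<Sum>s\<le>min m (L - k). g (m - s))"
    using vanish by (intro sum.mono_neutral_right) auto
  also have "\<dots> = fact (L - k) * fact (k + 1) * fact (L + 1) * (\<Sum>s\<le>min m (L - k).
      cheb_U (k - m + 2 * s) x /
       (fact (L - k - s) * fact (k + 1 + s) * fact (L + 1 - m + s) * fact (m - s)))"
    using coeff by (simp add: sum_distrib_left)
  finally have "weight_entry L k m x = sqrt (1 - x\<^sup>2) * ((real L + 1) / (real k + 1)) *
      (fact (L - m) * fact m / fact L) * (fact (L - k) * fact (k + 1) * fact (L + 1) *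
      (\<Sum>s\<le>min m (L - k). cheb_U (k - m + 2 * s) x /
       (fact (L - k - s) * fact (k + 1 + s) * fact (L + 1 - m + s) * fact (m - s))))"
    by (simp add: weight_entry_def g_def)
  moreover have "fact (k + 1) = (real k + 1) * fact k" by (simp add: add.commute)
  moreover have "(real k + 1) \<noteq> 0" by (simp add: add_eq_0_iff)
  ultimately show ?thesis by (simp del: fact_Suc)
qed

text \<open>The substitution $(k,m) \mapsto (L-m,L-k)$ swaps $m$ with $L-k$ and $k$ with $L-m$, while $k-m$
  is fixed; in the closed form this only permutes factors.\<close>

lemma weight_entry_flip:
  assumes "m \<le> k" "k \<le> L"
  shows "weight_entry L (L - m) (L - k) x = weight_entry L k m x"
proof -
  have mk: "L - k \<le> L - m" "L - m \<le> L" using assms by auto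
  have eq: "L - (L - m) = m" "L - (L - k) = k" "L - m - (L - k) = k - m"
    "L - m + 1 = L + 1 - m" "L + 1 - (L - k) = k + 1" "min (L - k) m = min m (L - k)"
    using assms by auto
  show ?thesis
    unfolding weight_entry_closed_form[OF assms] weight_entry_closed_form[OF mk] eq
    by (simp only: mult_ac)
qed

lemma weight_W_flip:
  assumes "i \<le> L" "j \<le> L"
  shows "weight_W L x $$ (L - i, L - j) = weight_W L x $$ (i, j)"
proof -
  have *: "L - j \<le> L - i" if "i \<le> j" for i j using that by simp
  show ?thesis
  proof (cases "i \<le> j")
    case True
    then have "L - i \<le> L - j \<longleftrightarrow> j \<le> i" using assms by linarith
    then show ?thesis
      using True assms weight_entry_flip[of i j L x] by (auto simp: weight_W_def)
  next
    case False
    then show ?thesis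
      using assms weight_entry_flip[of j i L x] by (auto simp: weight_W_def *)
  qed
qed

lemma weight_W_uminus:
  assumes "i \<le> L" "j \<le> L"
  shows "weight_W L (- x) $$ (i, j) = (-1) ^ (i + j) * weight_W L x $$ (i, j)"
proof (cases "j \<le> i")
  case True
  then show ?thesis
    using assms by (simp add: weight_W_def weight_entry_uminus[OF True])
next
  case False
  then have "i \<le> j" by simp
  then show ?thesis
    using assms False by (simp add: weight_W_def weight_entry_uminus[OF \<open>i \<le> j\<close>] add.commute)
qed

section \<open>Reversal, alternating signs and their conjugation\<close>

lemma J_mat_dim [simp]: "dim_row (J_mat N) = N" "dim_col (J_mat N) = N"
  by (simp_all add: J_mat_def)

lemma J_mat_carrier [simp]: "J_mat N \<in> carrier_mat N N"
  by (simp add: J_mat_def)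

lemma F_mat_carrier [simp]: "F_mat N \<in> carrier_mat N N"
  by (simp add: F_mat_def)

lemma J_mat_mult_index:
  assumes "X \<in> carrier_mat N M" "i < N" "j < M"
  shows "(J_mat N * X) $$ (i, j) = X $$ (N - 1 - i, j)"
proof -
  have "(J_mat N * X) $$ (i, j) = (\<Sum>k<N. (if k = N - 1 - i then 1 else 0) * X $$ (k, j))"
    using assms by (auto simp: J_mat_def scalar_prod_def lessThan_atLeast0 intro!: sum.cong)
  also have "\<dots> = (\<Sum>k<N. if N - 1 - i = k then X $$ (k, j) else 0)"
    by (intro sum.cong) auto
  finally show ?thesis using assms by (simp add: sum.delta)
qed

lemma mult_J_mat_index:
  assumes "X \<in> carrier_mat M N" "i < M" "j < N"
  shows "(X * J_mat N) $$ (i, j) = X $$ (i, N - 1 - j)"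
proof -
  have "(X * J_mat N) $$ (i, j) = (\<Sum>k<N. X $$ (i, k) * (if j = N - 1 - k then 1 else 0))"
    using assms by (auto simp: J_mat_def scalar_prod_def lessThan_atLeast0 intro!: sum.cong)
  also have "\<dots> = (\<Sum>k<N. if N - 1 - j = k then X $$ (i, k) else 0)"
    using assms by (intro sum.cong) auto
  finally show ?thesis using assms by (simp add: sum.delta)
qed

lemma transpose_J_mat: "transpose_mat (J_mat N) = J_mat N"
  by (rule eq_matI) (auto simp: J_mat_def)

lemma J_conjugation_index:
  assumes "X \<in> carrier_mat N N" "i < N" "j < N"
  shows "(J_mat N * X * J_mat N) $$ (i, j) = X $$ (N - 1 - i, N - 1 - j)"
  using assms
  by (simp add: mult_J_mat_index[of _ N N] J_mat_mult_index[of _ N N] mult_carrier_mat[of _ N N _ N]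
      del: index_mult_mat(1))

lemma F_mat_mult_index:
  assumes "X \<in> carrier_mat N M" "i < N" "j < M"
  shows "(F_mat N * X) $$ (i, j) = (-1) ^ i * X $$ (i, j)"
proof -
  have "(F_mat N * X) $$ (i, j) = (\<Sum>k<N. (if i = k then (-1) ^ i else 0) * X $$ (k, j))"
    using assms by (auto simp: F_mat_def scalar_prod_def lessThan_atLeast0 intro!: sum.cong)
  also have "\<dots> = (\<Sum>k<N. if i = k then (-1) ^ i * X $$ (k, j) else 0)"
    by (intro sum.cong) auto
  finally show ?thesis using assms by (simp add: sum.delta)
qed

lemma mult_F_mat_index:
  assumes "X \<in> carrier_mat M N" "i < M" "j < N"
  shows "(X * F_mat N) $$ (i, j) = (-1) ^ j * X $$ (i, j)"
proof -
  have "(X * F_mat N) $$ (i, j) = (\<Sum>k<N. X $$ (i, k) * (if k = j then (-1) ^ k else 0))"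
    using assms by (auto simp: F_mat_def scalar_prod_def lessThan_atLeast0 intro!: sum.cong)
  also have "\<dots> = (\<Sum>k<N. if j = k then (-1) ^ k * X $$ (i, k) else 0)"
    by (intro sum.cong) auto
  finally show ?thesis using assms by (simp add: sum.delta)
qed

lemma smult_mult_smult_mat:
  fixes a b :: "'a :: comm_semiring_0"
  assumes A: "A \<in> carrier_mat nr n" and B: "B \<in> carrier_mat n nc"
  shows "(a \<cdot>\<^sub>m A) * (b \<cdot>\<^sub>m B) = (a * b) \<cdot>\<^sub>m (A * B)"
  unfolding mult_smult_assoc_mat[OF A smult_carrier_mat[OF B]] mult_smult_distrib[OF A B]
  by (rule eq_matI) (simp_all add: mult.assoc)

text \<open>Conjugation by $JF$: as $J$ and $F$ are real symmetric involutions, $FJ$ is the inverse and the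
  adjoint of $JF$.\<close>

definition signed_flip :: "nat \<Rightarrow> complex mat \<Rightarrow> complex mat" where
  "signed_flip N X = J_mat N * F_mat N * X * F_mat N * J_mat N"

lemma signed_flip_dim [simp]: "dim_row (signed_flip N X) = N" "dim_col (signed_flip N X) = N"
  by (simp_all add: signed_flip_def J_mat_def)

lemma signed_flip_carrier [simp]: "signed_flip N X \<in> carrier_mat N N"
  by (rule carrier_matI) simp_all

text \<open>The sign picked up is $(-1)^{(N-1-i)+(N-1-j)}$, which depends only on the parity of $i+j$.\<close>

lemma signed_flip_index:
  assumes X: "X \<in> carrier_mat N N" and ij: "i < N" "j < N"
  shows "signed_flip N X $$ (i, j) = (-1) ^ (i + j) * X $$ (N - 1 - i, N - 1 - j)"
proof -
  have FX: "F_mat N * X \<in> carrier_mat N N" and FXF: "F_mat N * X * F_mat N \<in> carrier_mat N N"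
    using X by (auto intro!: mult_carrier_mat[of _ N N])
  have "signed_flip N X = J_mat N * (F_mat N * X * F_mat N) * J_mat N"
    unfolding signed_flip_def assoc_mult_mat[OF J_mat_carrier F_mat_carrier X]
      assoc_mult_mat[OF J_mat_carrier FX F_mat_carrier] ..
  then have "signed_flip N X $$ (i, j) = (J_mat N * (F_mat N * X * F_mat N)) $$ (i, N - 1 - j)"
    using mult_J_mat_index[OF mult_carrier_mat[OF J_mat_carrier FXF] ij] by simp
  also have "\<dots> = (F_mat N * X * F_mat N) $$ (N - 1 - i, N - 1 - j)"
    using ij by (intro J_mat_mult_index[OF FXF]) auto
  also have "\<dots> = (-1) ^ (N - 1 - j) * (F_mat N * X) $$ (N - 1 - i, N - 1 - j)"
    using ij by (intro mult_F_mat_index[OF FX]) auto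
  also have "(F_mat N * X) $$ (N - 1 - i, N - 1 - j)
      = (-1) ^ (N - 1 - i) * X $$ (N - 1 - i, N - 1 - j)"
    using ij by (intro F_mat_mult_index[OF X]) auto
  finally have "signed_flip N X $$ (i, j)
      = (-1) ^ (N - 1 - j) * ((-1) ^ (N - 1 - i) * X $$ (N - 1 - i, N - 1 - j))" .
  moreover have "(-1::complex) ^ (N - 1 - j) * (-1) ^ (N - 1 - i) = (-1) ^ (i + j)"
  proof -
    have "N - 1 - j + (N - 1 - i) + (i + j) = 2 * (N - 1)" using ij by simp
    then have "even (N - 1 - j + (N - 1 - i) + (i + j))" by (metis dvd_triv_left)
    then have "even (N - 1 - j + (N - 1 - i)) \<longleftrightarrow> even (i + j)"
      by (simp only: even_add[of "N - 1 - j + (N - 1 - i)"])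
    from minus_one_power_cong[OF this] show ?thesis by (simp only: power_add)
  qed
  ultimately show ?thesis by (simp only: mult.assoc[symmetric])
qed

lemma signed_flip_mult:
  assumes X: "X \<in> carrier_mat N N" and Y: "Y \<in> carrier_mat N N"
  shows "signed_flip N (X * Y) = signed_flip N X * signed_flip N Y"
proof (intro eq_matI)
  fix i j assume "i < dim_row (signed_flip N X * signed_flip N Y)"
    and "j < dim_col (signed_flip N X * signed_flip N Y)"
  then have ij: "i < N" "j < N" by simp_all
  have sign: "(-1::complex) ^ (i + k) * (-1) ^ (k + j) = (-1) ^ (i + j)" for k
  proof -
    have "even (i + k + (k + j)) \<longleftrightarrow> even (i + j)" by auto
    from minus_one_power_cong[OF this] show ?thesis by (simp only: power_add)
  qed
  have "(signed_flip N X * signed_flip N Y) $$ (i, j)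
      = (\<Sum>k<N. signed_flip N X $$ (i, k) * signed_flip N Y $$ (k, j))"
    using ij by (auto simp: scalar_prod_def lessThan_atLeast0 intro!: sum.cong)
  also have "\<dots> = (\<Sum>k<N. (-1) ^ (i + j) * (X $$ (N - 1 - i, N - 1 - k) * Y $$ (N - 1 - k, N - 1 - j)))"
  proof (intro sum.cong refl)
    fix k assume "k \<in> {..<N}"
    then have k: "k < N" by simp
    show "signed_flip N X $$ (i, k) * signed_flip N Y $$ (k, j)
        = (-1) ^ (i + j) * (X $$ (N - 1 - i, N - 1 - k) * Y $$ (N - 1 - k, N - 1 - j))"
      unfolding signed_flip_index[OF X ij(1) k] signed_flip_index[OF Y k ij(2)] sign[of k, symmetric]
      by (simp only: mult_ac)
  qed
  also have "\<dots> = (\<Sum>k<N. (-1) ^ (i + j) * (X $$ (N - 1 - i, k) * Y $$ (k, N - 1 - j)))"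
    by (subst sum.nat_diff_reindex[symmetric]) simp
  also have "\<dots> = (-1) ^ (i + j) * (X * Y) $$ (N - 1 - i, N - 1 - j)"
    using ij X Y by (auto simp: scalar_prod_def lessThan_atLeast0 sum_distrib_left intro!: sum.cong)
  also have "\<dots> = signed_flip N (X * Y) $$ (i, j)"
    using ij X Y by (simp add: signed_flip_index mult_carrier_mat[of _ N N _ N])
  finally show "signed_flip N (X * Y) $$ (i, j) = (signed_flip N X * signed_flip N Y) $$ (i, j)" ..
qed simp_all

lemma mat_adjoint_dim [simp]:
  "dim_row (mat_adjoint X) = dim_col X" "dim_col (mat_adjoint X) = dim_row X"
  by (simp_all add: mat_adjoint_def)

lemma mat_adjoint_carrier: "X \<in> carrier_mat N M \<Longrightarrow> mat_adjoint X \<in> carrier_mat M N"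
  by (auto simp: mat_adjoint_def)

lemma mat_adjoint_index:
  assumes "X \<in> carrier_mat N M" "i < M" "j < N"
  shows "mat_adjoint X $$ (i, j) = cnj (X $$ (j, i))"
  using assms by (simp add: mat_adjoint_def mat_of_rows_index)

lemma signed_flip_adjoint:
  assumes X: "X \<in> carrier_mat N N"
  shows "signed_flip N (mat_adjoint X) = mat_adjoint (signed_flip N X)"
proof (rule eq_matI)
  fix i j assume "i < dim_row (mat_adjoint (signed_flip N X))"
    and "j < dim_col (mat_adjoint (signed_flip N X))"
  then have ij: "i < N" "j < N" by simp_all
  then show "signed_flip N (mat_adjoint X) $$ (i, j) = mat_adjoint (signed_flip N X) $$ (i, j)"
    using X by (simp add: signed_flip_index mat_adjoint_carrier mat_adjoint_index[of _ N N] add.commute)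
qed simp_all

text \<open>The integrand of the orthogonality relation for the transformed weight and polynomials is
  reduced to the original integrand.\<close>

lemma signed_flip_triple_product:
  assumes "X \<in> carrier_mat N N" "V \<in> carrier_mat N N" "Z \<in> carrier_mat N N"
  shows "(a \<cdot>\<^sub>m signed_flip N X) * signed_flip N V * mat_adjoint (b \<cdot>\<^sub>m signed_flip N Z)
    = (a * cnj b) \<cdot>\<^sub>m signed_flip N (X * V * mat_adjoint Z)"
proof -
  have adj: "mat_adjoint (b \<cdot>\<^sub>m signed_flip N Z) = cnj b \<cdot>\<^sub>m signed_flip N (mat_adjoint Z)"
    unfolding signed_flip_adjoint[OF assms(3)]
    by (rule eq_matI) (simp_all add: mat_adjoint_index[of _ N N])
  have XV: "X * V \<in> carrier_mat N N" using assms by simp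
  have "(a \<cdot>\<^sub>m signed_flip N X) * signed_flip N V = a \<cdot>\<^sub>m signed_flip N (X * V)"
    unfolding signed_flip_mult[OF assms(1,2)]
    by (rule mult_smult_assoc_mat[of _ N N _ N]) simp_all
  then show ?thesis
    unfolding adj signed_flip_mult[OF XV mat_adjoint_carrier[OF assms(3)]]
    by (simp only:) (rule smult_mult_smult_mat[OF signed_flip_carrier signed_flip_carrier])
qed

section \<open>Orthogonal polynomials under reflection\<close>

text \<open>Substituting $-x$ multiplies the coefficient of $x^d$ by $(-1)^d$, and conjugation fixes the
  identity matrix, so the leading coefficient $I$ survives exactly because of the factor $(-1)^d$.\<close>

lemma monic_matrix_poly_signed_flip:
  assumes "monic_matrix_poly N d P"
  shows "monic_matrix_poly N d (\<lambda>x. (-1) ^ d \<cdot>\<^sub>m signed_flip N (P (- x)))"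
proof -
  obtain Q :: "complex poly mat" where Q: "Q \<in> carrier_mat N N"
    and deg: "\<And>i j. i < N \<Longrightarrow> j < N \<Longrightarrow> degree (Q $$ (i, j)) \<le> d"
    and monic: "map_mat (\<lambda>q. coeff q d) Q = 1\<^sub>m N"
    and P: "\<And>x. P x = map_mat (\<lambda>q. poly q (complex_of_real x)) Q"
    using assms unfolding monic_matrix_poly_def by blast
  have lead: "coeff (Q $$ (i, j)) d = (if i = j then 1 else 0)" if "i < N" "j < N" for i j
    using arg_cong[OF monic, of "\<lambda>M. M $$ (i, j)"] that Q by simp
  define R where "R = mat N N (\<lambda>(i, j).
    Polynomial.smult ((-1) ^ (d + (i + j))) (pcompose (Q $$ (N - 1 - i, N - 1 - j)) [:0, -1:]))"
  have "degree (R $$ (i, j)) \<le> d" if "i < N" "j < N" for i j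
    using that deg[of "N - 1 - i" "N - 1 - j"] by (simp add: R_def degree_pcompose)
  moreover have "map_mat (\<lambda>q. coeff q d) R = 1\<^sub>m N"
    by (intro eq_matI) (auto simp: R_def coeff_pcompose_linear lead minus_one_power_iff)
  moreover have "(-1) ^ d \<cdot>\<^sub>m signed_flip N (P (- x)) = map_mat (\<lambda>q. poly q (complex_of_real x)) R" for x
  proof -
    have "P (- x) \<in> carrier_mat N N" using Q by (simp add: P)
    then show ?thesis
      using Q by (intro eq_matI) (auto simp: signed_flip_index R_def poly_pcompose P power_add)
  qed
  ultimately show ?thesis
    unfolding monic_matrix_poly_def by (intro exI[of _ R]) (simp add: R_def)
qed

lemma set_integrable_reflect:
  fixes f :: "real \<Rightarrow> 'a :: {banach, second_countable_topology}"
  assumes "set_integrable lborel S f"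
  shows "set_integrable lborel {x. - x \<in> S} (\<lambda>x. f (- x))"
proof -
  have "indicator S (- x) = (indicator {x. - x \<in> S} x :: real)" for x
    by (auto simp: indicator_def)
  then show ?thesis
    using lborel_integrable_real_affine[OF assms[unfolded set_integrable_def], of "-1" 0]
    by (simp add: set_integrable_def)
qed

text \<open>Entry $(i,j)$ of each new integrand is, up to a constant sign, entry $(N-1-i,N-1-j)$ of the old
  one reflected at $0$, and $(-1,1)$ is symmetric about $0$.\<close>

lemma monic_orthogonal_polys_signed_flip:
  assumes V: "\<And>x. V x \<in> carrier_mat N N" and P: "monic_orthogonal_polys N V P"
  shows "monic_orthogonal_polys N (\<lambda>x. signed_flip N (V (- x)))
    (\<lambda>d x. (-1) ^ d \<cdot>\<^sub>m signed_flip N (P d (- x)))"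
proof -
  have monic: "monic_matrix_poly N d (P d)" for d
    using P by (simp add: monic_orthogonal_polys_def)
  have Pc: "P d x \<in> carrier_mat N N" for d x
    using monic[of d] unfolding monic_matrix_poly_def by auto
  define f where "f d d' i j x = (P d x * V x * mat_adjoint (P d' x)) $$ (i, j)" for d d' i j x
  define g where "g d d' i j x = (((-1) ^ d \<cdot>\<^sub>m signed_flip N (P d (- x))) * signed_flip N (V (- x)) *
    mat_adjoint ((-1) ^ d' \<cdot>\<^sub>m signed_flip N (P d' (- x)))) $$ (i, j)" for d d' i j x
  have g: "g d d' i j = (\<lambda>x. (-1) ^ (d + d' + (i + j)) * f d d' (N - 1 - i) (N - 1 - j) (- x))"
    if "i < N" "j < N" for d d' i j
  proof
    fix x
    have "P d (- x) * V (- x) * mat_adjoint (P d' (- x)) \<in> carrier_mat N N"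
      using Pc V mat_adjoint_carrier by (meson mult_carrier_mat)
    from signed_flip_index[OF this that]
    show "g d d' i j x = (-1) ^ (d + d' + (i + j)) * f d d' (N - 1 - i) (N - 1 - j) (- x)"
      using that unfolding g_def f_def signed_flip_triple_product[OF Pc V Pc]
      by (simp add: power_add)
  qed
  have "set_integrable lborel {-1<..<1} (g d d' i j) \<and> (LINT x:{-1<..<1}|lborel. g d d' i j x) = 0"
    if "d \<noteq> d'" and ij: "i < N" "j < N" for d d' i j
  proof -
    have int: "set_integrable lborel {-1<..<1} (f d d' (N - 1 - i) (N - 1 - j))"
      and zero: "(LINT x:{-1<..<1}|lborel. f d d' (N - 1 - i) (N - 1 - j) x) = 0"
      using P that unfolding monic_orthogonal_polys_def f_def by auto
    have sym: "{x. - x \<in> {-1<..<1::real}} = {-1<..<1}" by auto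
    then have "(LINT x:{-1<..<1}|lborel. f d d' (N - 1 - i) (N - 1 - j) (- x)) = 0"
      using zero set_integral_reflect[of "{-1<..<1}" "f d d' (N - 1 - i) (N - 1 - j)"] by simp
    then show ?thesis
      using set_integrable_reflect[OF int] unfolding g[OF ij] sym by simp
  qed
  then show ?thesis
    unfolding monic_orthogonal_polys_def g_def using monic_matrix_poly_signed_flip[OF monic] by blast
qed

section \<open>Block diagonalization\<close>

text \<open>A matrix that commutes with the reversal of all $2(n+1)$ indices preserves the spaces of vectors
  $(v, Jv)$ and $(-Jv, v)$; the rows of $Y$ are orthonormal bases of these two spaces. The
  off-diagonal blocks cancel because $J^2 = I$.\<close>

lemma Y_block_diagonalization:
  fixes n :: nat and A B :: "complex mat"
  defines "J \<equiv> J_mat (n + 1)"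
  assumes A: "A \<in> carrier_mat (n + 1) (n + 1)" and B: "B \<in> carrier_mat (n + 1) (n + 1)"
  shows "Y_mat n * four_block_mat A B (J * B * J) (J * A * J) * transpose_mat (Y_mat n)
    = four_block_mat (A + B * J) (0\<^sub>m (n + 1) (n + 1)) (0\<^sub>m (n + 1) (n + 1)) (J * A * J - J * B)"
proof -
  define N where "N = n + 1"
  define c where "c = complex_of_real (1 / sqrt 2)"
  have A': "A \<in> carrier_mat N N" and B': "B \<in> carrier_mat N N" and J: "J \<in> carrier_mat N N"
    using A B by (simp_all add: N_def J_def)
  have "(sqrt 2 :: real) * sqrt 2 = 2" by simp
  then have cc: "c * c = 1 / 2"
    unfolding c_def of_real_mult[symmetric] by (simp add: field_simps)
  note index = mult_J_mat_index[of _ N N] J_mat_mult_index[of _ N N] mult_carrier_mat[of _ N N _ N]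
    minus_carrier_mat[of _ N N]
  define M where "M = four_block_mat (1\<^sub>m N) J (- J) (1\<^sub>m N)"
  define M' where "M' = four_block_mat (1\<^sub>m N) (- J) J (1\<^sub>m N)"
  define Wb where "Wb = four_block_mat A B (J * B * J) (J * A * J)"
  have M: "M \<in> carrier_mat (N + N) (N + N)" and M': "M' \<in> carrier_mat (N + N) (N + N)"
    and Wb: "Wb \<in> carrier_mat (N + N) (N + N)"
    using A' B' J by (auto simp: M_def M'_def Wb_def)
  have Y: "Y_mat n = c \<cdot>\<^sub>m M"
    by (simp add: Y_mat_def c_def M_def N_def J_def)
  have Mt: "transpose_mat M = M'"
    using J unfolding M_def M'_def
    by (subst transpose_four_block_mat[of _ N N _ N _ N])
      (auto simp: transpose_uminus J_def transpose_J_mat)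
  then have Yt: "transpose_mat (Y_mat n) = c \<cdot>\<^sub>m M'"
    unfolding Y Mt[symmetric] by (intro eq_matI) simp_all
  have 1: "1\<^sub>m N * A + J * (J * B * J) = A + B * J" "1\<^sub>m N * B + J * (J * A * J) = B + A * J"
    "- J * A + 1\<^sub>m N * (J * B * J) = J * B * J - J * A" "- J * B + 1\<^sub>m N * (J * A * J) = J * A * J - J * B"
    using A' B' unfolding J_def N_def[symmetric]
    by (intro eq_matI; simp add: index del: index_mult_mat(1))+
  have MW: "M * Wb = four_block_mat (A + B * J) (B + A * J) (J * B * J - J * A) (J * A * J - J * B)"
    unfolding M_def Wb_def 1[symmetric]
    using A' B' J by (intro mult_four_block_mat[of _ N N _ N _ N _ _ N _ N]) auto
  have 2: "(A + B * J) * 1\<^sub>m N + (B + A * J) * J = 2 \<cdot>\<^sub>m (A + B * J)"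
    "(A + B * J) * - J + (B + A * J) * 1\<^sub>m N = 2 \<cdot>\<^sub>m 0\<^sub>m N N"
    "(J * B * J - J * A) * 1\<^sub>m N + (J * A * J - J * B) * J = 2 \<cdot>\<^sub>m 0\<^sub>m N N"
    "(J * B * J - J * A) * - J + (J * A * J - J * B) * 1\<^sub>m N = 2 \<cdot>\<^sub>m (J * A * J - J * B)"
    using A' B' unfolding J_def N_def[symmetric]
    by (intro eq_matI; simp add: index del: index_mult_mat(1))+
  have "M * Wb * M' = four_block_mat ((A + B * J) * 1\<^sub>m N + (B + A * J) * J)
    ((A + B * J) * - J + (B + A * J) * 1\<^sub>m N)
    ((J * B * J - J * A) * 1\<^sub>m N + (J * A * J - J * B) * J)
    ((J * B * J - J * A) * - J + (J * A * J - J * B) * 1\<^sub>m N)"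
    unfolding MW M'_def
    using A' B' J by (intro mult_four_block_mat[of _ N N _ N _ N _ _ N _ N]) auto
  also have "\<dots> = 2 \<cdot>\<^sub>m four_block_mat (A + B * J) (0\<^sub>m N N) (0\<^sub>m N N) (J * A * J - J * B)"
    unfolding 2
    using A' B' J by (intro smult_four_block_mat[symmetric, of _ N N _ N _ N]) auto
  finally have MWM: "M * Wb * M' = \<dots>" .
  have "Y_mat n * Wb * transpose_mat (Y_mat n) = (c * c) \<cdot>\<^sub>m (M * Wb * M')"
    unfolding Yt unfolding Y mult_smult_assoc_mat[OF M Wb]
    by (rule smult_mult_smult_mat[OF mult_carrier_mat[OF M Wb] M'])
  also have "\<dots> = four_block_mat (A + B * J) (0\<^sub>m N N) (0\<^sub>m N N) (J * A * J - J * B)"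
    unfolding MWM cc by (rule eq_matI) auto
  finally show ?thesis unfolding Wb_def N_def .
qed

lemma block_carrier [simp]:
  "block_A n x \<in> carrier_mat (n + 1) (n + 1)" "block_B n x \<in> carrier_mat (n + 1) (n + 1)"
  by (simp_all add: block_A_def block_B_def)

lemma block_dim [simp]:
  "dim_row (block_A n x) = n + 1" "dim_col (block_A n x) = n + 1"
  "dim_row (block_B n x) = n + 1" "dim_col (block_B n x) = n + 1"
  by (simp_all add: block_A_def block_B_def)

lemma block_A_plus_block_B_J_carrier:
  "block_A n x + block_B n x * J_mat (n + 1) \<in> carrier_mat (n + 1) (n + 1)"
  by (rule add_carrier_mat, rule mult_carrier_mat) (rule block_carrier J_mat_carrier)+

lemma weight_W_blocks:
  "weight_W (2 * n + 1) x = four_block_mat (block_A n x) (block_B n x)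
     (J_mat (n + 1) * block_B n x * J_mat (n + 1)) (J_mat (n + 1) * block_A n x * J_mat (n + 1))"
  (is "?W = four_block_mat ?A ?B ?C ?D")
proof (rule eq_matI)
  fix i j assume "i < dim_row (four_block_mat ?A ?B ?C ?D)" "j < dim_col (four_block_mat ?A ?B ?C ?D)"
  then have ij: "i < 2 * n + 2" "j < 2 * n + 2"
    by (simp_all add: block_A_def)
  have flip: "?W $$ (i, j) = ?W $$ (2 * n + 1 - i, 2 * n + 1 - j)"
    using ij by (intro weight_W_flip[symmetric]) auto
  show "?W $$ (i, j) = four_block_mat ?A ?B ?C ?D $$ (i, j)"
  proof (cases "i < n + 1")
    case True
    then show ?thesis using ij by (auto simp: block_A_def block_B_def)
  next
    case False
    have C: "?C $$ (i - (n + 1), j) = ?W $$ (2 * n + 1 - i, 2 * n + 1 - j)" if "j < n + 1"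
    proof -
      have "n - (i - (n + 1)) = 2 * n + 1 - i" "n + 1 + (n - j) = 2 * n + 1 - j"
        using False that by auto
      then show ?thesis
        using False that ij by (subst J_conjugation_index) (auto simp: block_B_def)
    qed
    have D: "?D $$ (i - (n + 1), j - (n + 1)) = ?W $$ (2 * n + 1 - i, 2 * n + 1 - j)" if "\<not> j < n + 1"
    proof -
      have "n - (i - (n + 1)) = 2 * n + 1 - i" "n - (j - (n + 1)) = 2 * n + 1 - j"
        using False that by auto
      then show ?thesis
        using False that ij by (subst J_conjugation_index) (auto simp: block_A_def)
    qed
    have dims: "dim_row ?A = n + 1" "dim_col ?A = n + 1" "dim_row ?D = n + 1" "dim_col ?D = n + 1"
      by (simp_all add: block_A_def)
    show ?thesis
      using False ij
      by (subst index_mat_four_block)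
        (auto simp only: dims flip C D if_False if_True not_False_eq_True split: if_split)
  qed
qed (simp_all add: weight_W_def block_A_def)

text \<open>After reflection, entry $(n-i,n-j)$ of $A$ has the sign $(-1)^{i+j}$, which the conjugation
  cancels. The same entry of $BJ$ is the entry of $W$ in row $n-i$ and column $n+1+j$, whose index sum
  has the opposite parity, so $B$ changes sign.\<close>

lemma signed_flip_W1:
  "signed_flip (n + 1) (block_A n (- x) + block_B n (- x) * J_mat (n + 1))
    = J_mat (n + 1) * block_A n x * J_mat (n + 1) - J_mat (n + 1) * block_B n x"
  (is "signed_flip _ ?V = ?R")
proof (rule eq_matI)
  fix i j assume "i < dim_row ?R" "j < dim_col ?R"
  then have ij: "i < n + 1" "j < n + 1" by (simp_all add: block_B_def)
  have V: "?V \<in> carrier_mat (n + 1) (n + 1)"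
    by (rule block_A_plus_block_B_J_carrier)
  have sign_A: "(-1 :: complex) ^ (n - i + (n - j)) = (-1) ^ (i + j)"
    using ij by (intro minus_one_power_cong) auto
  have "(-1 :: complex) ^ (n - i + (n + 1 + j)) = (-1) ^ (i + j + 1)"
    using ij by (intro minus_one_power_cong) auto
  then have sign_B: "(-1 :: complex) ^ (n - i + (n + 1 + j)) = - ((-1) ^ (i + j))"
    by simp
  have "block_A n (- x) $$ (n - i, n - j) = (-1) ^ (n - i + (n - j)) * block_A n x $$ (n - i, n - j)"
    using ij weight_W_uminus[of "n - i" "2 * n + 1" "n - j" x] by (simp add: block_A_def)
  then have A: "block_A n (- x) $$ (n - i, n - j) = (-1) ^ (i + j) * block_A n x $$ (n - i, n - j)"
    by (simp only: sign_A)
  have "block_B n (- x) $$ (n - i, j) = (-1) ^ (n - i + (n + 1 + j)) * block_B n x $$ (n - i, j)"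
    using ij weight_W_uminus[of "n - i" "2 * n + 1" "n + 1 + j" x] by (simp add: block_B_def)
  then have B: "block_B n (- x) $$ (n - i, j) = - ((-1) ^ (i + j) * block_B n x $$ (n - i, j))"
    by (simp only: sign_B mult_minus_left)
  have "signed_flip (n + 1) ?V $$ (i, j)
      = (-1) ^ (i + j) * (block_A n (- x) $$ (n - i, n - j) + block_B n (- x) $$ (n - i, j))"
    using ij signed_flip_index[OF V ij]
      mult_J_mat_index[OF block_carrier(2)[of n "- x"], where i = "n - i" and j = "n - j"]
    by (simp del: index_mult_mat(1))
  also have "\<dots> = block_A n x $$ (n - i, n - j) - block_B n x $$ (n - i, j)"
    unfolding A B by (simp add: algebra_simps minus_one_power_iff)
  also have "\<dots> = ?R $$ (i, j)"
    using ij J_conjugation_index[OF block_carrier(1) ij] J_mat_mult_index[OF block_carrier(2) ij]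
    by (simp del: index_mult_mat(1))
  finally show "signed_flip (n + 1) ?V $$ (i, j) = ?R $$ (i, j)" .
qed (simp_all add: block_B_def)

theorem corollary6p6:
  fixes n :: nat
    and W W1 W2 :: "real \<Rightarrow> complex mat"
  assumes W: "W = weight_W (2 * n + 1)"
    and W1: "W1 = (\<lambda>x. block_A n x + block_B n x * J_mat (n + 1))"
    and W2: "W2 = (\<lambda>x. J_mat (n + 1) * F_mat (n + 1) * W1 (- x) * F_mat (n + 1) * J_mat (n + 1))"
  shows "(\<forall>x \<in> {-1..1}.
            W x = four_block_mat (block_A n x) (block_B n x)
                    (dt_mat (block_B n x)) (dt_mat (block_A n x)) \<and>
            Y_mat n * W x * transpose_mat (Y_mat n) =
              four_block_mat (W1 x) (0\<^sub>m (n + 1) (n + 1)) (0\<^sub>m (n + 1) (n + 1)) (W2 x)) \<and>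
         (\<forall>P1 P2 :: nat \<Rightarrow> real \<Rightarrow> complex mat.
            monic_orthogonal_polys (n + 1) W1 P1 \<longrightarrow>
            P2 = (\<lambda>d x. (-1) ^ d \<cdot>\<^sub>m
                   (J_mat (n + 1) * F_mat (n + 1) * P1 d (- x) * F_mat (n + 1) * J_mat (n + 1))) \<longrightarrow>
            monic_orthogonal_polys (n + 1) W2 P2)"
proof (intro conjI ballI allI impI)
  fix x
  have dt: "dt_mat (block_A n x) = J_mat (n + 1) * block_A n x * J_mat (n + 1)"
    "dt_mat (block_B n x) = J_mat (n + 1) * block_B n x * J_mat (n + 1)"
    by (simp_all add: dt_mat_def block_A_def block_B_def)
  show "W x = four_block_mat (block_A n x) (block_B n x) (dt_mat (block_B n x)) (dt_mat (block_A n x))"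
    unfolding W dt by (rule weight_W_blocks)
  have "W2 x = J_mat (n + 1) * block_A n x * J_mat (n + 1) - J_mat (n + 1) * block_B n x"
    unfolding W2 W1 signed_flip_def[symmetric] by (rule signed_flip_W1)
  then show "Y_mat n * W x * transpose_mat (Y_mat n) =
      four_block_mat (W1 x) (0\<^sub>m (n + 1) (n + 1)) (0\<^sub>m (n + 1) (n + 1)) (W2 x)"
    unfolding W W1 weight_W_blocks by (simp only: Y_block_diagonalization block_carrier)
next
  fix P1 P2 :: "nat \<Rightarrow> real \<Rightarrow> complex mat"
  assume P1: "monic_orthogonal_polys (n + 1) W1 P1"
    and P2: "P2 = (\<lambda>d x. (-1) ^ d \<cdot>\<^sub>m
      (J_mat (n + 1) * F_mat (n + 1) * P1 d (- x) * F_mat (n + 1) * J_mat (n + 1)))"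
  have "W1 x \<in> carrier_mat (n + 1) (n + 1)" for x
    unfolding W1 by (rule block_A_plus_block_B_J_carrier)
  from monic_orthogonal_polys_signed_flip[OF this P1] show "monic_orthogonal_polys (n + 1) W2 P2"
    unfolding W2 P2 signed_flip_def .
qed

end
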